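(* Let $K$ be an infinite field, $R=K[x,y,z]$, and $I=(x^a,y^b,z^c,x^\alpha y^\beta z^\gamma)$, where $0\le\alpha<a$, $0\le\beta<b$, $0\le\gamma<c$ are integers and at most one of $\alpha,\beta,\gamma$ is zero. Suppose $a+b+c+\alpha+\beta+\gamma\equiv 0\pmod 3$, put $s=\frac13(a+b+c+\alpha+\beta+\gamma)-2$, $A=s+2-a$, $B=s+2-b$, $C=s+2-c$, $M=s+2-(\alpha+\beta+\gamma)$, and assume $0\le M$, $0\le A\le\beta+\gamma$, $0\le B\le\alpha+\gamma$, $0\le C\le\alpha+\beta$. Then the interlaced basis region $H_{a,b,c,\alpha,\beta,\gamma}$ of $[R/I]_s$ and $[R/I]_{s+1}$ is in the shape of a (possibly degenerate) hexagon with side-lengths, in clockwise cyclic order starting at the bottom, $$(A,\;B+M,\;C,\;A+M,\;B,\;C+M)$$ and with a puncture in the shape of an equilateral triangle of side-length $M$. The puncture has sides parallel to the sides of the hexagon of lengths $A+M$, $B+M$ and $C+M$. Moreover, the puncture is located $\alpha,\beta,\gamma$ units from the sides of length $A+M$, $B+M$ and $C+M$, respectively.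
   Context: Interlaced basis region. Consider the equilateral triangle of side-length $s+2$ with barycentric-type coordinates $(u,v,w)$, $u,v,w\ge0$, $u+v+w=s+2$, drawn so that the vertex with $v=w=0$ is at the lower-center, the vertex with $u=w=0$ at the upper right, and the vertex with $u=v=0$ at the upper left, tiled by unit equilateral triangles cut out by the lines $u,v,w\in\mathbb Z$. Each monomial $x^iy^jz^k$ of degree $s+1$ corresponds to the unit triangle $\{u\ge i,\ v\ge j,\ w\ge k\}$, and each monomial $x^iy^jz^k$ of degree $s$ corresponds to the oppositely oriented unit triangle $\{u\le i+1,\ v\le j+1,\ w\le k+1\}$; two such triangles share an edge exactly when one monomial divides the other. The interlaced basis region of $[R/I]_s$ and $[R/I]_{s+1}$ is the union of the unit triangles corresponding to the monomials of degrees $s$ and $s+1$ that are not in $I$. The sides referred to are: the bottom side of length $A$ (on $u=a$), then clockwise the sides on $v=0$, $w=c$, $u=0$, $v=b$, $w=0$. Distances are measured in units of the triangular lattice, i.e. the line $u=\alpha$ is $\alpha$ units from the line $u=0$, etc. Sides may have length zero, and a puncture of side-length $0$ means there is no hole. *)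

theory Defs
  imports "HOL-Analysis.Analysis" "HOL-Library.Poly_Mapping" "HOL-Library.Product_Plus"
begin

text \<open>The polynomial ring in three variables, as the monoid algebra of
  \<open>\<nat> \<times> \<nat> \<times> \<nat>\<close>: an element maps each exponent triple to its coefficient.\<close>

type_synonym 'k poly3 = "(nat \<times> nat \<times> nat) \<Rightarrow>\<^sub>0 'k"

definition varX :: "'k::comm_ring_1 poly3" where
  "varX = Poly_Mapping.single (1, 0, 0) 1"

definition varY :: "'k::comm_ring_1 poly3" where
  "varY = Poly_Mapping.single (0, 1, 0) 1"

definition varZ :: "'k::comm_ring_1 poly3" where
  "varZ = Poly_Mapping.single (0, 0, 1) 1"

definition mono3 :: "nat \<Rightarrow> nat \<Rightarrow> nat \<Rightarrow> 'k::comm_ring_1 poly3" where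
  "mono3 i j k = varX ^ i * varY ^ j * varZ ^ k"

definition ideal_generated :: "'a::comm_ring_1 set \<Rightarrow> 'a set" where
  "ideal_generated = module.span (*)"

lemma module_self: "module ((*) :: 'a::comm_ring_1 \<Rightarrow> 'a \<Rightarrow> 'a)"
  by standard (auto simp: algebra_simps)

text \<open>Drawing of the plane \<open>u + v + w = s + 2\<close> in the Euclidean plane.  The vertices of the triangle
  of side-length \<open>s + 2\<close> are \<open>0\<close> (\<open>v = w = 0\<close>, lower-center), \<open>(s + 2) * cis (pi / 3)\<close>
  (\<open>u = w = 0\<close>, upper right) and \<open>(s + 2) * cis (2 * pi / 3)\<close> (\<open>u = v = 0\<close>, upper left), so the
  barycentric combination of the vertices with weights \<open>u / (s + 2)\<close>, \<open>v / (s + 2)\<close>, \<open>w / (s + 2)\<close>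
  is the point below; \<open>u\<close> drops out because its vertex is the origin.\<close>

definition tri_point :: "real \<Rightarrow> real \<Rightarrow> complex" where
  "tri_point v w = of_real v * cis (pi / 3) + of_real w * cis (2 * pi / 3)"

definition tri_set :: "int \<Rightarrow> (real \<Rightarrow> real \<Rightarrow> real \<Rightarrow> bool) \<Rightarrow> complex set" where
  "tri_set s \<Phi> = {tri_point v w | u v w. u + v + w = real_of_int s + 2 \<and> \<Phi> u v w}"

definition downward_triangle :: "int \<Rightarrow> nat \<Rightarrow> nat \<Rightarrow> nat \<Rightarrow> complex set" where
  "downward_triangle s i j k = tri_set s (\<lambda>u v w. real i \<le> u \<and> real j \<le> v \<and> real k \<le> w)"

definition upward_triangle :: "int \<Rightarrow> nat \<Rightarrow> nat \<Rightarrow> nat \<Rightarrow> complex set" where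
  "upward_triangle s i j k =
     tri_set s (\<lambda>u v w. u \<le> real i + 1 \<and> v \<le> real j + 1 \<and> w \<le> real k + 1)"

definition interlaced_basis_region :: "'k::comm_ring_1 poly3 set \<Rightarrow> int \<Rightarrow> complex set" where
  "interlaced_basis_region I s =
     \<Union> {downward_triangle s i j k | i j k. int (i + j + k) = s + 1 \<and> mono3 i j k \<notin> I} \<union>
     \<Union> {upward_triangle s i j k | i j k. int (i + j + k) = s \<and> mono3 i j k \<notin> I}"

text \<open>Directions of the six sides of a hexagon with all angles \<open>2 * pi / 3\<close>, traversed clockwise.
  Side \<open>0\<close> is the bottom side, traversed from right to left.\<close>

definition hex_dir :: "nat \<Rightarrow> complex" where
  "hex_dir i = cis (pi - real i * pi / 3)"

text \<open>The points \<open>P 0, \<dots>, P 5\<close> are the vertices, and side \<open>i\<close> runs from \<open>P i\<close> to the next vertex.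
  A side may have length zero; it still has a direction and hence a supporting line.  Since the
  hexagon is convex, its region is the convex hull of the vertices.\<close>

definition clockwise_hexagon :: "real list \<Rightarrow> (nat \<Rightarrow> complex) \<Rightarrow> bool" where
  "clockwise_hexagon ls P \<longleftrightarrow> length ls = 6 \<and>
     (\<forall>i<6. 0 \<le> ls ! i \<and> P ((i + 1) mod 6) - P i = of_real (ls ! i) * hex_dir i)"

definition hex_region :: "(nat \<Rightarrow> complex) \<Rightarrow> complex set" where
  "hex_region P = convex hull (P ` {..<6})"

definition line_through :: "complex \<Rightarrow> complex \<Rightarrow> complex set" where
  "line_through p d = range (\<lambda>t::real. p + of_real t * d)"

definition side_line :: "(nat \<Rightarrow> complex) \<Rightarrow> nat \<Rightarrow> complex set" where
  "side_line P i = line_through (P i) (hex_dir i)"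

definition equilateral_triangle :: "real \<Rightarrow> complex \<Rightarrow> complex \<Rightarrow> complex \<Rightarrow> bool" where
  "equilateral_triangle l p q r \<longleftrightarrow> dist p q = l \<and> dist q r = l \<and> dist r p = l"

text \<open>A region with a puncture keeps the boundary of the hole, as it is a union of closed unit
  triangles, except where that boundary runs along the outer boundary with nothing of the region
  next to it.  Removing a single point (a puncture of side-length zero) from a region without
  isolated points leaves no hole.\<close>

definition punctured :: "complex set \<Rightarrow> complex set \<Rightarrow> complex set" where
  "punctured S T = closure (S - T)"

text \<open>Euclidean distance divided by the height of the unit triangle, so that the lines
  \<open>u = \<alpha>\<close> and \<open>u = 0\<close> are \<open>\<bar>\<alpha>\<bar>\<close> units apart.\<close>

definition lattice_distance :: "complex set \<Rightarrow> complex set \<Rightarrow> real" where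
  "lattice_distance S T = setdist S T / (sqrt 3 / 2)"

text \<open>The segment from \<open>p\<close> to \<open>q\<close> is parallel to side \<open>i\<close> of the hexagon, and its supporting line
  in that direction is \<open>d\<close> units from the supporting line of the side.\<close>

definition parallel_at_distance ::
  "complex \<Rightarrow> complex \<Rightarrow> (nat \<Rightarrow> complex) \<Rightarrow> nat \<Rightarrow> real \<Rightarrow> bool" where
  "parallel_at_distance p q P i d \<longleftrightarrow>
     closed_segment p q \<subseteq> line_through p (hex_dir i) \<and>
     lattice_distance (line_through p (hex_dir i)) (side_line P i) = d"

end

theory Submission
  imports Defs
begin

text \<open>
  Write \<open>T = s + 2\<close>, so that the points of the plane are the triples with \<open>u + v + w = T\<close>.  The
  numerical hypotheses give \<open>A + B + C + M = T\<close>.  The hexagon is cut out by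
  \<open>0 \<le> u \<le> a\<close>, \<open>0 \<le> v \<le> b\<close>, \<open>0 \<le> w \<le> c\<close>, and the puncture by \<open>\<alpha> \<le> u\<close>, \<open>\<beta> \<le> v\<close>, \<open>\<gamma> \<le> w\<close>.  These
  inequality descriptions are matched with the convex hulls of the vertices in
  \<open>convex_hull_hexagon\<close> and \<open>convex_hull_triangle\<close>; the relation \<open>A + B + C + M = T\<close> gives the side
  lengths, and \<open>A \<le> \<beta> + \<gamma>\<close> and its two analogues say that the puncture stays inside the hexagon.

  The ideal \<open>I\<close> is generated by monomials, so a monomial lies in \<open>I\<close> iff a generator divides it
  (\<open>mono3_in_ideal_iff\<close>).  Hence the unit triangles of the region are those of the positions
  \<open>(i, j, k)\<close> with \<open>i < a\<close>, \<open>j < b\<close>, \<open>k < c\<close> and one of \<open>i < \<alpha>\<close>, \<open>j < \<beta>\<close>, \<open>k < \<gamma>\<close>.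

  Each unit triangle, pointing up or down, lies in the box \<open>[i, i + 1] \<times> [j, j + 1] \<times> [k, k + 1]\<close>.
  So it lies in the hexagon, and because \<open>i < \<alpha>\<close> implies \<open>i + 1 \<le> \<alpha>\<close> its interior misses the
  puncture; the triangle is the closure of its interior, hence lies in the punctured hexagon.
  Conversely, the region is a finite union of closed triangles, so it suffices to cover a point of
  the hexagon outside the puncture.  If for example \<open>u < \<alpha>\<close>, round \<open>u\<close> down and round \<open>v\<close>, \<open>w\<close> to
  the largest natural numbers strictly below them, and \<open>0\<close> to \<open>0\<close> (\<open>lattice_cell_cover\<close>):
  rounding down keeps \<open>i < \<alpha>\<close>, strictness keeps \<open>j < b\<close>, \<open>k < c\<close> even on the boundary, and the sum of the three
  roundings can only be \<open>T - 1\<close> or \<open>T - 2\<close>, which are the two degrees in question.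
\<close>

section \<open>Monomial ideals\<close>

text \<open>The elements whose support consists of multiples of generators form an ideal, and the generators
  lie in it; so no other monomial can be in the generated ideal.\<close>

lemma monomial_in_monomial_ideal_iff:
  fixes N :: "'m::comm_monoid_add set"
  shows "Poly_Mapping.single m (1 :: 'k::comm_ring_1)
           \<in> ideal_generated ((\<lambda>n. Poly_Mapping.single n 1) ` N)
         \<longleftrightarrow> (\<exists>n\<in>N. \<exists>d. m = d + n)"
    (is "?x \<in> ideal_generated ?G \<longleftrightarrow> _")
proof
  define U where "U = {d + n |d n. n \<in> N}"
  define J where "J = {p :: 'm \<Rightarrow>\<^sub>0 'k. Poly_Mapping.keys p \<subseteq> U}"
  have U_up: "d + n \<in> U" if "n \<in> U" for d n
    using that unfolding U_def by (auto simp: add.assoc[symmetric]) (metis add.assoc)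
  have "module.subspace (*) J"
  proof (subst module.subspace_def[OF module_self], intro conjI ballI allI)
    show "0 \<in> J" by (simp add: J_def)
  next
    fix p q assume "p \<in> J" "q \<in> J"
    then show "p + q \<in> J"
      using Poly_Mapping.keys_add[of p q] by (auto simp: J_def)
  next
    fix r p assume "p \<in> J"
    then show "r * p \<in> J"
      using keys_mult[of r p] U_up by (fastforce simp: J_def)
  qed
  moreover have "?G \<subseteq> J"
    unfolding J_def U_def by (auto intro: exI[of _ 0])
  ultimately have "ideal_generated ?G \<subseteq> J"
    unfolding ideal_generated_def by (rule module.span_minimal[OF module_self, rotated])
  moreover assume "?x \<in> ideal_generated ?G"
  ultimately have "?x \<in> J" by blast
  then show "\<exists>n\<in>N. \<exists>d. m = d + n"
    by (auto simp: J_def U_def)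
next
  assume "\<exists>n\<in>N. \<exists>d. m = d + n"
  then obtain n d where n: "n \<in> N" and m: "m = d + n" by blast
  have "Poly_Mapping.single d 1 * Poly_Mapping.single n 1 \<in> ideal_generated ?G"
    unfolding ideal_generated_def
    using n by (intro module.span_scale[OF module_self] module.span_base[OF module_self]) auto
  then show "?x \<in> ideal_generated ?G" by (simp add: m mult_single)
qed

lemma mono3_eq_single:
  "mono3 i j k = (Poly_Mapping.single (i, j, k) 1 :: 'k::comm_ring_1 poly3)"
proof -
  have "varX ^ i = (Poly_Mapping.single (i, 0, 0) 1 :: 'k poly3)"
    by (induction i) (simp_all add: varX_def mult_single flip: zero_prod_def single_one)
  moreover have "varY ^ j = (Poly_Mapping.single (0, j, 0) 1 :: 'k poly3)"
    by (induction j) (simp_all add: varY_def mult_single flip: zero_prod_def single_one)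
  moreover have "varZ ^ k = (Poly_Mapping.single (0, 0, k) 1 :: 'k poly3)"
    by (induction k) (simp_all add: varZ_def mult_single flip: zero_prod_def single_one)
  ultimately show ?thesis by (simp add: mono3_def mult_single)
qed

lemma mono3_in_ideal_iff:
  "mono3 i j k \<in> ideal_generated
       {varX ^ a, varY ^ b, varZ ^ c, varX ^ \<alpha> * varY ^ \<beta> * varZ ^ \<gamma> :: 'k::comm_ring_1 poly3}
   \<longleftrightarrow> a \<le> i \<or> b \<le> j \<or> c \<le> k \<or> (\<alpha> \<le> i \<and> \<beta> \<le> j \<and> \<gamma> \<le> k)"
proof -
  have gens: "{varX ^ a, varY ^ b, varZ ^ c, varX ^ \<alpha> * varY ^ \<beta> * varZ ^ \<gamma> :: 'k poly3}
      = (\<lambda>n. Poly_Mapping.single n 1) ` {(a, 0, 0), (0, b, 0), (0, 0, c), (\<alpha>, \<beta>, \<gamma>)}"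
    using mono3_eq_single[where 'k='k, of a 0 0] mono3_eq_single[where 'k='k, of 0 b 0]
      mono3_eq_single[where 'k='k, of 0 0 c] mono3_eq_single[where 'k='k, of \<alpha> \<beta> \<gamma>]
    by (simp add: mono3_def)
  have dvd: "(\<exists>d. (i, j, k) = d + (p, q, r)) \<longleftrightarrow> p \<le> i \<and> q \<le> j \<and> r \<le> k" for p q r :: nat
    by (auto simp: le_iff_add add.commute)
  show ?thesis
    unfolding gens mono3_eq_single monomial_in_monomial_ideal_iff
    by (simp only: bex_simps dvd simp_thms le0)
qed

section \<open>Coordinates of the triangular lattice\<close>

text \<open>Together with \<open>coord_w\<close>, the inverse of \<open>tri_point\<close>.  As these functions are linear and continuous,
  weak inequalities between lattice coordinates define closed convex sets.\<close>

definition coord_v :: "complex \<Rightarrow> real" where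
  "coord_v z = Im z / sqrt 3 + Re z"

definition coord_w :: "complex \<Rightarrow> real" where
  "coord_w z = Im z / sqrt 3 - Re z"

lemma tri_point_eq_Complex: "tri_point v w = Complex ((v - w) / 2) (sqrt 3 / 2 * (v + w))"
proof -
  have "2 * pi / 3 = pi - pi / 3" by simp
  then have "cis (2 * pi / 3) = Complex (- 1 / 2) (sqrt 3 / 2)"
    by (simp only: cis.ctr cos_pi_minus sin_pi_minus sin_60 cos_60) simp
  then show ?thesis
    by (simp add: tri_point_def complex_eq_iff cos_60 sin_60 field_simps)
qed

lemma coord_tri_point [simp]: "coord_v (tri_point v w) = v" "coord_w (tri_point v w) = w"
  by (simp_all add: coord_v_def coord_w_def tri_point_eq_Complex field_simps)

lemma tri_point_coord [simp]: "tri_point (coord_v z) (coord_w z) = z"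
  by (simp add: coord_v_def coord_w_def tri_point_eq_Complex complex_eq_iff)

lemma tri_point_linear [simp]:
  "tri_point v w + tri_point v' w' = tri_point (v + v') (w + w')"
  "tri_point v w - tri_point v' w' = tri_point (v - v') (w - w')"
  "of_real r * tri_point v w = tri_point (r * v) (r * w)"
  "r *\<^sub>R tri_point v w = tri_point (r * v) (r * w)"
  by (simp_all add: tri_point_def algebra_simps scaleR_conv_of_real)

lemma tri_point_inject [simp]: "tri_point v w = tri_point v' w' \<longleftrightarrow> v = v' \<and> w = w'"
  by (metis coord_tri_point)

lemma coord_add [simp]:
  "coord_v (x + y) = coord_v x + coord_v y" "coord_w (x + y) = coord_w x + coord_w y"
  by (simp_all add: coord_v_def coord_w_def add_divide_distrib)

lemma coord_scaleR [simp]: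
  "coord_v (r *\<^sub>R x) = r * coord_v x" "coord_w (r *\<^sub>R x) = r * coord_w x"
  by (simp_all add: coord_v_def coord_w_def algebra_simps)

lemma continuous_on_coord [continuous_intros]:
  "continuous_on S coord_v" "continuous_on S coord_w"
  unfolding coord_v_def coord_w_def by (intro continuous_intros; simp)+

lemma tri_set_eq_Collect:
  "tri_set s \<Phi> = {z. \<Phi> (real_of_int s + 2 - coord_v z - coord_w z) (coord_v z) (coord_w z)}"
proof (intro equalityI subsetI)
  fix z assume "z \<in> {z. \<Phi> (real_of_int s + 2 - coord_v z - coord_w z) (coord_v z) (coord_w z)}"
  moreover define u where "u = real_of_int s + 2 - coord_v z - coord_w z"
  moreover have "u + coord_v z + coord_w z = real_of_int s + 2" "z = tri_point (coord_v z) (coord_w z)"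
    by (simp_all add: u_def)
  ultimately show "z \<in> tri_set s \<Phi>"
    unfolding tri_set_def by blast
next
  fix z assume "z \<in> tri_set s \<Phi>"
  then obtain u v w where z: "z = tri_point v w" "\<Phi> u v w" "u + v + w = real_of_int s + 2"
    unfolding tri_set_def by blast
  then have "u = real_of_int s + 2 - v - w" by linarith
  with z show "z \<in> {z. \<Phi> (real_of_int s + 2 - coord_v z - coord_w z) (coord_v z) (coord_w z)}"
    by simp
qed

lemma tri_point_in_tri_set_iff [simp]:
  "tri_point v w \<in> tri_set s \<Phi> \<longleftrightarrow> \<Phi> (real_of_int s + 2 - v - w) v w"
  by (simp add: tri_set_eq_Collect)

lemma convex_tri_point_between:
  assumes "convex S" "tri_point v\<^sub>0 w\<^sub>0 \<in> S" "tri_point v\<^sub>1 w\<^sub>1 \<in> S"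
    and "0 \<le> t" "t \<le> 1"
  shows "tri_point ((1 - t) * v\<^sub>0 + t * v\<^sub>1) ((1 - t) * w\<^sub>0 + t * w\<^sub>1) \<in> S"
  using convexD_alt[OF assms] by simp

lemma real_between_obtain:
  fixes x y z :: real
  assumes "x \<le> y" "y \<le> z"
  obtains t where "0 \<le> t" "t \<le> 1" "y = (1 - t) * x + t * z"
proof -
  have "y \<in> closed_segment x z" using assms by (simp add: closed_segment_eq_real_ivl)
  then show thesis using that by (auto simp: closed_segment_def)
qed

text \<open>Along a lattice line one coordinate is constant and a second one determines the third, so a point
  of the line is between two others as soon as one non-constant coordinate is.  Convexity thus
  becomes a condition on a single coordinate, in three versions for the three kinds of lines.\<close>

lemma convex_slide_u:
  assumes "convex S" "tri_point v\<^sub>0 w\<^sub>0 \<in> S" "tri_point v\<^sub>1 w\<^sub>1 \<in> S"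
    and "v\<^sub>0 + w\<^sub>0 = v + w" "v\<^sub>1 + w\<^sub>1 = v + w" "v\<^sub>0 \<le> v" "v \<le> v\<^sub>1"
  shows "tri_point v w \<in> S"
proof -
  obtain t where t: "0 \<le> t" "t \<le> 1" "v = (1 - t) * v\<^sub>0 + t * v\<^sub>1"
    using assms by (metis real_between_obtain)
  have w: "w\<^sub>0 = v + w - v\<^sub>0" "w\<^sub>1 = v + w - v\<^sub>1" using assms by auto
  have "(1 - t) * w\<^sub>0 + t * w\<^sub>1 = v + w - ((1 - t) * v\<^sub>0 + t * v\<^sub>1)"
    unfolding w by (simp add: algebra_simps)
  then have "w = (1 - t) * w\<^sub>0 + t * w\<^sub>1" using t(3) by simp
  then show ?thesis using convex_tri_point_between[OF assms(1-3) t(1,2)] t(3) by metis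
qed

lemma convex_slide_v:
  assumes "convex S" "tri_point v w\<^sub>0 \<in> S" "tri_point v w\<^sub>1 \<in> S" "w\<^sub>0 \<le> w" "w \<le> w\<^sub>1"
  shows "tri_point v w \<in> S"
proof -
  obtain t where t: "0 \<le> t" "t \<le> 1" "w = (1 - t) * w\<^sub>0 + t * w\<^sub>1"
    using assms by (metis real_between_obtain)
  then show ?thesis
    using convex_tri_point_between[OF assms(1-3) t(1,2)] by (simp flip: distrib_right)
qed

lemma convex_slide_w:
  assumes "convex S" "tri_point v\<^sub>0 w \<in> S" "tri_point v\<^sub>1 w \<in> S" "v\<^sub>0 \<le> v" "v \<le> v\<^sub>1"
  shows "tri_point v w \<in> S"
proof -
  obtain t where t: "0 \<le> t" "t \<le> 1" "v = (1 - t) * v\<^sub>0 + t * v\<^sub>1"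
    using assms by (metis real_between_obtain)
  then show ?thesis
    using convex_tri_point_between[OF assms(1-3) t(1,2)] by (simp flip: distrib_right)
qed

lemma convex_coord_bounds:
  "convex {z. l \<le> coord_v z}" "convex {z. coord_v z \<le> l}"
  "convex {z. l \<le> coord_w z}" "convex {z. coord_w z \<le> l}"
  "convex {z. coord_v z + coord_w z \<le> l}" "convex {z. l \<le> coord_v z + coord_w z}"
proof -
  have "linear coord_v" "linear coord_w" "linear (\<lambda>z. coord_v z + coord_w z)"
    by (auto intro!: linearI simp: algebra_simps)
  note L = this
  have le: "convex {z. f z \<le> l}" and ge: "convex {z. l \<le> f z}" if "linear f" for f :: "complex \<Rightarrow> real"
    using convex_linear_vimage[OF that, of "{..l}"] convex_linear_vimage[OF that, of "{l..}"]
    by (simp_all add: vimage_def)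
  show "convex {z. l \<le> coord_v z}" "convex {z. coord_v z \<le> l}"
    "convex {z. l \<le> coord_w z}" "convex {z. coord_w z \<le> l}"
    "convex {z. coord_v z + coord_w z \<le> l}" "convex {z. l \<le> coord_v z + coord_w z}"
    by (intro le ge L)+
qed

lemma convex_tri_box:
  "convex (tri_set s (\<lambda>u v w. u\<^sub>0 \<le> u \<and> u \<le> u\<^sub>1 \<and> v\<^sub>0 \<le> v \<and> v \<le> v\<^sub>1 \<and> w\<^sub>0 \<le> w \<and> w \<le> w\<^sub>1))"
proof -
  have "tri_set s (\<lambda>u v w. u\<^sub>0 \<le> u \<and> u \<le> u\<^sub>1 \<and> v\<^sub>0 \<le> v \<and> v \<le> v\<^sub>1 \<and> w\<^sub>0 \<le> w \<and> w \<le> w\<^sub>1)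
    = {z. coord_v z + coord_w z \<le> s + 2 - u\<^sub>0} \<inter> {z. s + 2 - u\<^sub>1 \<le> coord_v z + coord_w z}
      \<inter> {z. v\<^sub>0 \<le> coord_v z} \<inter> {z. coord_v z \<le> v\<^sub>1} \<inter> {z. w\<^sub>0 \<le> coord_w z} \<inter> {z. coord_w z \<le> w\<^sub>1}"
    by (auto simp: tri_set_eq_Collect)
  then show ?thesis by (simp add: convex_Int convex_coord_bounds)
qed

section \<open>The hexagon and the puncture as convex hulls\<close>

text \<open>Moving a point of the hexagon along its line of constant \<open>u\<close> in both directions, it leaves through
  one of the sides on \<open>v = 0\<close>, \<open>w = c\<close> and one of the sides on \<open>v = b\<close>, \<open>w = 0\<close>, and
  each side is the segment between two vertices.  The remaining two sides have constant \<open>u\<close> and are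
  not crossed.\<close>

lemma convex_hull_hexagon:
  fixes a b c T :: real
  assumes T: "T = real_of_int s + 2"
    and "a \<le> T" "b \<le> T" "c \<le> T" "T \<le> a + b" "T \<le> a + c" "T \<le> b + c"
  shows "convex hull {tri_point (T - a) 0, tri_point 0 (T - a), tri_point 0 c,
             tri_point (T - c) c, tri_point b (T - b), tri_point b 0}
       = tri_set s (\<lambda>u v w. 0 \<le> u \<and> u \<le> a \<and> 0 \<le> v \<and> v \<le> b \<and> 0 \<le> w \<and> w \<le> c)"
    (is "convex hull ?V = ?H")
proof
  show "convex hull ?V \<subseteq> ?H"
    by (rule hull_minimal) (use assms in \<open>auto intro: convex_tri_box\<close>)
next
  let ?K = "convex hull ?V"
  have K: "convex ?K" by (rule convex_convex_hull)
  have vert: "x \<in> ?V \<Longrightarrow> x \<in> ?K" for x by (rule hull_inc)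
  have side_v0: "tri_point 0 w \<in> ?K" if "T - a \<le> w" "w \<le> c" for w
    by (rule convex_slide_v[OF K, of _ "T - a" c]) (use that in \<open>auto intro!: vert\<close>)
  have side_wc: "tri_point v c \<in> ?K" if "0 \<le> v" "v \<le> T - c" for v
    by (rule convex_slide_w[OF K, of 0 _ "T - c"]) (use that in \<open>auto intro!: vert\<close>)
  have side_vb: "tri_point b w \<in> ?K" if "0 \<le> w" "w \<le> T - b" for w
    by (rule convex_slide_v[OF K, of _ 0 "T - b"]) (use that in \<open>auto intro!: vert\<close>)
  have side_w0: "tri_point v 0 \<in> ?K" if "T - a \<le> v" "v \<le> b" for v
    by (rule convex_slide_w[OF K, of "T - a" _ b]) (use that in \<open>auto intro!: vert\<close>)
  show "?H \<subseteq> ?K"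
  proof
    fix z assume z: "z \<in> ?H"
    define v w where "v = coord_v z" and "w = coord_w z"
    have vw: "v + w \<le> T" "T - a \<le> v + w" "0 \<le> v" "v \<le> b" "0 \<le> w" "w \<le> c"
      using z by (auto simp: tri_set_eq_Collect v_def w_def T)
    have "\<exists>v\<^sub>0 w\<^sub>0. tri_point v\<^sub>0 w\<^sub>0 \<in> ?K \<and> v\<^sub>0 + w\<^sub>0 = v + w \<and> v\<^sub>0 \<le> v"
    proof (cases "v + w \<le> c")
      case True
      then show ?thesis using side_v0[of "v + w"] vw by (intro exI[of _ 0] exI[of _ "v + w"]) auto
    next
      case False
      then show ?thesis using side_wc[of "v + w - c"] vw
        by (intro exI[of _ "v + w - c"] exI[of _ c]) auto
    qed
    moreover have "\<exists>v\<^sub>1 w\<^sub>1. tri_point v\<^sub>1 w\<^sub>1 \<in> ?K \<and> v\<^sub>1 + w\<^sub>1 = v + w \<and> v \<le> v\<^sub>1"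
    proof (cases "v + w \<le> b")
      case True
      then show ?thesis using side_w0[of "v + w"] vw by (intro exI[of _ "v + w"] exI[of _ 0]) auto
    next
      case False
      then show ?thesis using side_vb[of "v + w - b"] vw
        by (intro exI[of _ b] exI[of _ "v + w - b"]) auto
    qed
    ultimately have "tri_point v w \<in> ?K" using convex_slide_u[OF K] by blast
    then show "z \<in> ?K" by (simp add: v_def w_def)
  qed
qed

text \<open>Here the line of constant \<open>u\<close> leaves through the sides on \<open>v = \<beta>\<close> and \<open>w = \<gamma>\<close>.  For \<open>M = 0\<close> all
  three vertices coincide; sliding covers this case too, unlike weights with denominator \<open>M\<close>.\<close>

lemma convex_hull_triangle:
  fixes \<alpha> \<beta> \<gamma> M :: real
  assumes M: "\<alpha> + \<beta> + \<gamma> + M = real_of_int s + 2" "0 \<le> M"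
  shows "convex hull {tri_point \<beta> \<gamma>, tri_point (\<beta> + M) \<gamma>, tri_point \<beta> (\<gamma> + M)}
       = tri_set s (\<lambda>u v w. \<alpha> \<le> u \<and> \<beta> \<le> v \<and> \<gamma> \<le> w)"
    (is "convex hull ?V = ?H")
proof
  have "?H = tri_set s (\<lambda>u v w. \<alpha> \<le> u \<and> u \<le> \<alpha> + M \<and> \<beta> \<le> v \<and> v \<le> \<beta> + M \<and> \<gamma> \<le> w \<and> w \<le> \<gamma> + M)"
    using M by (auto simp: tri_set_eq_Collect)
  then have "convex ?H" by (simp add: convex_tri_box)
  then show "convex hull ?V \<subseteq> ?H"
    by (intro hull_minimal) (use assms in auto)
next
  let ?K = "convex hull ?V"
  have K: "convex ?K" by (rule convex_convex_hull)
  have vert: "x \<in> ?V \<Longrightarrow> x \<in> ?K" for x by (rule hull_inc)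
  show "?H \<subseteq> ?K"
  proof
    fix z assume z: "z \<in> ?H"
    define v w where "v = coord_v z" and "w = coord_w z"
    have vw: "v + w \<le> \<beta> + \<gamma> + M" "\<beta> \<le> v" "\<gamma> \<le> w"
      using z M by (auto simp: tri_set_eq_Collect v_def w_def)
    have "tri_point \<beta> (v + w - \<beta>) \<in> ?K"
      by (rule convex_slide_v[OF K, of _ \<gamma> "\<gamma> + M"]) (use vw in \<open>auto intro!: vert\<close>)
    moreover have "tri_point (v + w - \<gamma>) \<gamma> \<in> ?K"
      by (rule convex_slide_w[OF K, of \<beta> _ "\<beta> + M"]) (use vw in \<open>auto intro!: vert\<close>)
    ultimately have "tri_point v w \<in> ?K"
      by (rule convex_slide_u[OF K]) (use vw in auto)
    then show "z \<in> ?K" by (simp add: v_def w_def)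
  qed
qed

section \<open>Lines in the lattice directions\<close>

lemma hex_dir_eq_tri_point:
  "hex_dir 0 = tri_point (- 1) 1" "hex_dir 1 = tri_point 0 1" "hex_dir 2 = tri_point 1 0"
  "hex_dir 3 = tri_point 1 (- 1)" "hex_dir 4 = tri_point 0 (- 1)" "hex_dir 5 = tri_point (- 1) 0"
proof -
  have angles: "pi - pi / 3 = 2 * pi / 3" "pi - 2 * pi / 3 = pi / 3" "pi - 4 * pi / 3 = - (pi / 3)"
    "pi - 5 * pi / 3 = - (2 * pi / 3)" by simp_all
  have c2: "cis (2 * pi / 3) = Complex (- 1 / 2) (sqrt 3 / 2)"
    using tri_point_eq_Complex[of 0 1] by (simp add: tri_point_def)
  have c1: "cis (pi / 3) = Complex (1 / 2) (sqrt 3 / 2)"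
    using tri_point_eq_Complex[of 1 0] by (simp add: tri_point_def)
  show "hex_dir 0 = tri_point (- 1) 1" "hex_dir 1 = tri_point 0 1" "hex_dir 2 = tri_point 1 0"
    "hex_dir 3 = tri_point 1 (- 1)" "hex_dir 4 = tri_point 0 (- 1)" "hex_dir 5 = tri_point (- 1) 0"
    by (simp_all add: hex_dir_def tri_point_eq_Complex angles c1 c2 complex_eq_iff flip: cis_cnj)
qed

lemma lessThan_6: "{..<6::nat} = {0, 1, 2, 3, 4, 5}"
  by auto

lemma clockwise_hexagonI:
  assumes "0 \<le> l\<^sub>0" "0 \<le> l\<^sub>1" "0 \<le> l\<^sub>2" "0 \<le> l\<^sub>3" "0 \<le> l\<^sub>4" "0 \<le> l\<^sub>5"
    and "P 1 - P 0 = of_real l\<^sub>0 * hex_dir 0" "P 2 - P 1 = of_real l\<^sub>1 * hex_dir 1"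
    and "P 3 - P 2 = of_real l\<^sub>2 * hex_dir 2" "P 4 - P 3 = of_real l\<^sub>3 * hex_dir 3"
    and "P 5 - P 4 = of_real l\<^sub>4 * hex_dir 4" "P 0 - P 5 = of_real l\<^sub>5 * hex_dir 5"
  shows "clockwise_hexagon [l\<^sub>0, l\<^sub>1, l\<^sub>2, l\<^sub>3, l\<^sub>4, l\<^sub>5] P"
proof -
  have "(\<forall>i<6. \<Phi> i) \<longleftrightarrow> \<Phi> 0 \<and> \<Phi> 1 \<and> \<Phi> 2 \<and> \<Phi> 3 \<and> \<Phi> 4 \<and> \<Phi> 5" for \<Phi> :: "nat \<Rightarrow> bool"
  proof -
    have "(\<forall>i<6. \<Phi> i) \<longleftrightarrow> (\<forall>i\<in>{..<6}. \<Phi> i)" by (simp add: Ball_def)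
    then show ?thesis by (simp add: lessThan_6)
  qed
  note all = this
  have succ: "(0 + 1) mod 6 = (1::nat)" "(1 + 1) mod 6 = (2::nat)" "(2 + 1) mod 6 = (3::nat)"
    "(3 + 1) mod 6 = (4::nat)" "(4 + 1) mod 6 = (5::nat)" "(5 + 1) mod 6 = (0::nat)"
    by simp_all
  show ?thesis
    unfolding clockwise_hexagon_def all succ using assms by simp
qed

lemma in_line_through_iff:
  "tri_point v w \<in> line_through (tri_point v\<^sub>0 w\<^sub>0) (tri_point x y)
     \<longleftrightarrow> (\<exists>t. v = v\<^sub>0 + t * x \<and> w = w\<^sub>0 + t * y)"
  by (auto simp: line_through_def)

lemma line_through_u:
  assumes "x = 1 \<or> x = - 1" "v\<^sub>0 + w\<^sub>0 = real_of_int s + 2 - u\<^sub>0"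
  shows "line_through (tri_point v\<^sub>0 w\<^sub>0) (tri_point x (- x)) = tri_set s (\<lambda>u v w. u = u\<^sub>0)"
proof -
  have "tri_point v w \<in> line_through (tri_point v\<^sub>0 w\<^sub>0) (tri_point x (- x))
      \<longleftrightarrow> tri_point v w \<in> tri_set s (\<lambda>u v w. u = u\<^sub>0)" for v w
    unfolding in_line_through_iff using assms by (auto intro!: exI[of _ "x * (v - v\<^sub>0)"])
  from this[of "coord_v z" "coord_w z" for z] show ?thesis by auto
qed

lemma line_through_v:
  assumes "x = 1 \<or> x = - 1"
  shows "line_through (tri_point v\<^sub>0 w\<^sub>0) (tri_point 0 x) = tri_set s (\<lambda>u v w. v = v\<^sub>0)"
proof -
  have "tri_point v w \<in> line_through (tri_point v\<^sub>0 w\<^sub>0) (tri_point 0 x)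
      \<longleftrightarrow> tri_point v w \<in> tri_set s (\<lambda>u v w. v = v\<^sub>0)" for v w
    unfolding in_line_through_iff using assms by (auto intro!: exI[of _ "x * (w - w\<^sub>0)"])
  from this[of "coord_v z" "coord_w z" for z] show ?thesis by auto
qed

lemma line_through_w:
  assumes "x = 1 \<or> x = - 1"
  shows "line_through (tri_point v\<^sub>0 w\<^sub>0) (tri_point x 0) = tri_set s (\<lambda>u v w. w = w\<^sub>0)"
proof -
  have "tri_point v w \<in> line_through (tri_point v\<^sub>0 w\<^sub>0) (tri_point x 0)
      \<longleftrightarrow> tri_point v w \<in> tri_set s (\<lambda>u v w. w = w\<^sub>0)" for v w
    unfolding in_line_through_iff using assms by (auto intro!: exI[of _ "x * (v - v\<^sub>0)"])
  from this[of "coord_v z" "coord_w z" for z] show ?thesis by auto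
qed

text \<open>Multiplication by \<open>cnj d\<close> rotates the lines to horizontal ones, whose distance is the difference
  of the imaginary parts.\<close>

lemma setdist_parallel_lines:
  assumes d: "norm d = 1"
  shows "setdist (line_through p d) (line_through q d) = \<bar>Im (cnj d * (p - q))\<bar>"
proof -
  define h where "h = Im (cnj d * (p - q))"
  define r where "r = Re (cnj d * (p - q))"
  have dd: "d * cnj d = 1" using complex_norm_square[of d] d by simp
  have pq: "p - q = d * Complex r h"
  proof -
    have "Complex r h = cnj d * (p - q)" by (simp add: h_def r_def complex_eq_iff)
    then show ?thesis using dd by (simp only: mult.assoc[symmetric] mult_1_left)
  qed
  \<comment> \<open>the foot of the perpendicular from \<open>p\<close> to the second line\<close>
  define q' where "q' = q + of_real r * d"
  have "p - q' = d * (Complex r h - of_real r)"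
    using pq by (simp add: q'_def algebra_simps)
  also have "Complex r h - of_real r = \<i> * of_real h" by (simp add: complex_eq_iff)
  finally have dist: "dist p q' = \<bar>h\<bar>" by (simp add: dist_norm norm_mult d)
  have "setdist (line_through p d) (line_through q d) = dist p q'"
  proof (rule setdist_unique)
    show "p \<in> line_through p d" unfolding line_through_def by (auto intro: range_eqI[of _ _ 0])
    show "q' \<in> line_through q d" unfolding line_through_def q'_def by auto
  next
    fix x y assume "x \<in> line_through p d \<and> y \<in> line_through q d"
    then obtain t t' where x: "x = p + of_real t * d" and y: "y = q + of_real t' * d"
      unfolding line_through_def by auto
    have "cnj d * (x - y) = cnj d * (p - q) + of_real (t - t') * (d * cnj d)"
      by (simp add: x y algebra_simps)
    then have "h = Im (cnj d * (x - y))" by (simp add: dd h_def)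
    also have "\<bar>\<dots>\<bar> \<le> norm (cnj d * (x - y))" by (rule abs_Im_le_cmod)
    also have "\<dots> = dist x y" by (simp add: norm_mult d dist_norm)
    finally show "dist p q' \<le> dist x y" by (simp add: dist)
  qed
  then show ?thesis by (simp add: dist h_def)
qed

lemma norm_tri_point_sqr: "(norm (tri_point v w))\<^sup>2 = v\<^sup>2 + v * w + w\<^sup>2"
  by (simp add: tri_point_eq_Complex cmod_power2 power_mult_distrib power_divide)
     (simp add: power2_eq_square field_simps)

lemma norm_tri_point:
  "norm (tri_point v 0) = \<bar>v\<bar>" "norm (tri_point 0 v) = \<bar>v\<bar>" "norm (tri_point v (- v)) = \<bar>v\<bar>"
  "norm (tri_point (- v) v) = \<bar>v\<bar>"
proof -
  have *: "norm z = \<bar>v\<bar>" if "(norm z)\<^sup>2 = v\<^sup>2" for z :: complex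
    using that by (metis abs_norm_cancel power2_eq_iff abs_minus_cancel)
  show "norm (tri_point v 0) = \<bar>v\<bar>" "norm (tri_point 0 v) = \<bar>v\<bar>" "norm (tri_point v (- v)) = \<bar>v\<bar>"
    "norm (tri_point (- v) v) = \<bar>v\<bar>"
    by (rule *; simp only: norm_tri_point_sqr; simp add: power2_eq_square)+
qed

text \<open>The area form in lattice coordinates is \<open>sqrt 3 / 2\<close>, the height of the unit triangle, times the
  determinant, and the height is the unit of \<open>lattice_distance\<close>.\<close>

lemma lattice_distance_line_through:
  assumes "norm (tri_point x y) = 1"
  shows "lattice_distance (line_through (tri_point v w) (tri_point x y))
           (line_through (tri_point v' w') (tri_point x y)) = \<bar>x * (w - w') - y * (v - v')\<bar>"
proof -
  have "Im (cnj (tri_point x y) * (tri_point v w - tri_point v' w'))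
      = sqrt 3 / 2 * (x * (w - w') - y * (v - v'))"
    by (simp add: tri_point_eq_Complex field_simps)
  then show ?thesis
    unfolding lattice_distance_def setdist_parallel_lines[OF assms] by (simp only: abs_mult) simp
qed

lemma closed_segment_subset_line_through:
  assumes "q = p + of_real r * d"
  shows "closed_segment p q \<subseteq> line_through p d"
proof
  fix z assume "z \<in> closed_segment p q"
  then obtain t where "z = p + t *\<^sub>R (q - p)"
    by (auto simp: closed_segment_def algebra_simps)
  then have "z = p + of_real (t * r) * d" using assms by (simp add: scaleR_conv_of_real)
  then show "z \<in> line_through p d" unfolding line_through_def by blast
qed

lemma parallel_at_distance_tri_point:
  assumes "P i = tri_point v\<^sub>0 w\<^sub>0" "hex_dir i = tri_point x y" "norm (tri_point x y) = 1"
    and "v' = v + r * x" "w' = w + r * y"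
    and "d = \<bar>x * (w - w\<^sub>0) - y * (v - v\<^sub>0)\<bar>"
  shows "parallel_at_distance (tri_point v w) (tri_point v' w') P i d"
proof -
  have "closed_segment (tri_point v w) (tri_point v' w') \<subseteq> line_through (tri_point v w) (hex_dir i)"
    by (rule closed_segment_subset_line_through[where r = r]) (use assms in simp)
  then show ?thesis
    unfolding parallel_at_distance_def side_line_def
    using lattice_distance_line_through[OF assms(3)] assms(1,2,6) by simp
qed

section \<open>Covering by unit triangles\<close>

text \<open>The floor of \<open>u\<close> is at most \<open>u\<close> and more than \<open>u - 1\<close>; a ceiling decreased by one is less than
  its argument and at least the argument minus one.  So the sum of the three roundings lies strictly
  between \<open>T - 3\<close> and \<open>T\<close>.  The truncation in \<open>nat\<close> matters for \<open>v = 0\<close> or \<open>w = 0\<close>, where the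
  rounding is \<open>0\<close>; not both can vanish, since \<open>u < T\<close>.\<close>

lemma lattice_cell_cover:
  fixes u v w :: real and T :: int and \<alpha> b c :: nat
  assumes "u + v + w = T" "0 \<le> u" "0 \<le> v" "v \<le> b" "0 \<le> w" "w \<le> c"
    and "u < \<alpha>" "\<alpha> \<le> T" "0 < b" "0 < c"
  obtains (down) i j k :: nat where "i < \<alpha>" "j < b" "k < c"
      "int (i + j + k) = T - 1" "i \<le> u" "j \<le> v" "k \<le> w"
    | (up) i j k :: nat where "i < \<alpha>" "j < b" "k < c"
      "int (i + j + k) = T - 2" "u \<le> real i + 1" "v \<le> real j + 1" "w \<le> real k + 1"
proof -
  define i j k where "i = nat \<lfloor>u\<rfloor>" and "j = nat (\<lceil>v\<rceil> - 1)" and "k = nat (\<lceil>w\<rceil> - 1)"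
  have i: "real i \<le> u" "u < real i + 1" "i < \<alpha>"
    using assms(2,7) unfolding i_def by linarith+
  have j: "v \<le> real j + 1" "real j \<le> v" "j < b" "0 < v \<Longrightarrow> real j < v"
    using assms(3,4,9) unfolding j_def by linarith+
  have k: "w \<le> real k + 1" "real k \<le> w" "k < c" "0 < w \<Longrightarrow> real k < w"
    using assms(5,6,10) unfolding k_def by linarith+
  have "0 < v \<or> 0 < w" using assms(1,3,5,7,8) by linarith
  then have "real i + real j + real k < T"
    using i(1) j(2,4) k(2,4) assms(1) by fastforce
  moreover have "T - 3 < real i + real j + real k"
    using i(2) j(1) k(1) assms(1) by linarith
  ultimately have "int (i + j + k) = T - 1 \<or> int (i + j + k) = T - 2" by linarith
  then show thesis
    using down[OF i(3) j(3) k(3) _ i(1) j(2) k(2)] up[OF i(3) j(3) k(3) _ _ j(1) k(1)] i(2)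
    by auto
qed

section \<open>The interlaced basis region\<close>

lemma closed_downward_triangle: "closed (downward_triangle s i j k)"
  unfolding downward_triangle_def tri_set_eq_Collect
  by (intro closed_Collect_conj closed_Collect_le continuous_intros)

lemma closed_upward_triangle: "closed (upward_triangle s i j k)"
  unfolding upward_triangle_def tri_set_eq_Collect
  by (intro closed_Collect_conj closed_Collect_le continuous_intros)

lemma finite_triples_of_degree: "finite {(i, j, k). int (i + j + k) = n}"
  by (rule finite_subset[of _ "{..nat n} \<times> {..nat n} \<times> {..nat n}"]) auto

lemma closed_interlaced_basis_region: "closed (interlaced_basis_region I s)"
proof -
  have fin: "finite {f i j k | i j k. int (i + j + k) = n \<and> mono3 i j k \<notin> I}"
    for f :: "nat \<Rightarrow> nat \<Rightarrow> nat \<Rightarrow> complex set" and n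
    by (rule finite_subset[OF _ finite_imageI[OF finite_triples_of_degree[of n], of "\<lambda>(i, j, k). f i j k"]])
      (auto simp: image_iff)
  show ?thesis
    unfolding interlaced_basis_region_def
    by (intro closed_Un closed_Union fin)
       (auto intro: closed_downward_triangle closed_upward_triangle)
qed

text \<open>A point \<open>p\<close> is the limit of the open segment from \<open>p\<close> to \<open>g\<close>.  This gives the closure of the
  interior of a unit triangle without computing interiors.\<close>

lemma subset_closure_if_open_segments:
  fixes g :: "'a::euclidean_space"
  assumes "\<And>p t. p \<in> D \<Longrightarrow> 0 < t \<Longrightarrow> t \<le> 1 \<Longrightarrow> (1 - t) *\<^sub>R p + t *\<^sub>R g \<in> S"
  shows "D \<subseteq> closure S"
proof
  fix p assume p: "p \<in> D"
  show "p \<in> closure S"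
  proof (cases "p = g")
    case True
    then show ?thesis using assms[OF p, of 1] closure_subset by auto
  next
    case False
    then have "closure (open_segment p g) = closed_segment p g" by simp
    moreover have "open_segment p g \<subseteq> S" using assms[OF p] by (auto simp: in_segment)
    ultimately have "closed_segment p g \<subseteq> closure S" using closure_mono by metis
    then show ?thesis by auto
  qed
qed

text \<open>The centroid of a unit triangle satisfies all three defining inequalities strictly, hence so does
  every point of a segment from the triangle to its centroid, except possibly its starting point.\<close>

lemma unit_triangles_subset_closure:
  fixes i j k :: nat
  assumes S: "tri_set s (\<lambda>u v w. real i < u \<and> u < real i + 1 \<and> real j < v \<and> v < real j + 1
      \<and> real k < w \<and> w < real k + 1) \<subseteq> S"
  shows "int (i + j + k) = s + 1 \<Longrightarrow> downward_triangle s i j k \<subseteq> closure S"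
    and "int (i + j + k) = s \<Longrightarrow> upward_triangle s i j k \<subseteq> closure S"
proof -
  have mix: "0 < (1 - t) * x + t * y" if "0 \<le> x" "0 < y" "0 < t" "t \<le> 1" for x y t :: real
    using that by (intro add_nonneg_pos mult_nonneg_nonneg mult_pos_pos) auto
  show "downward_triangle s i j k \<subseteq> closure S" if "int (i + j + k) = s + 1"
  proof (rule subset_closure_if_open_segments)
    have s: "real_of_int s = real i + real j + real k - 1" using that by linarith
    fix p and t :: real assume p: "p \<in> downward_triangle s i j k" and t: "0 < t" "t \<le> 1"
    define v w where "v = coord_v p" and "w = coord_w p"
    have p_eq: "p = tri_point v w" by (simp add: v_def w_def)
    have nn: "0 \<le> real j + real k + 1 - v - w" "0 \<le> v - real j" "0 \<le> w - real k"
      using p s by (auto simp: p_eq downward_triangle_def)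
    define v' w' where "v' = (1 - t) * v + t * (real j + 1/3)" and "w' = (1 - t) * w + t * (real k + 1/3)"
    have "0 < real j + real k + 1 - v' - w'" "0 < v' - real j" "0 < w' - real k"
      using mix[OF nn(1), of "1/3" t] mix[OF nn(2), of "1/3" t] mix[OF nn(3), of "1/3" t] t
      by (simp_all add: v'_def w'_def algebra_simps)
    then have "tri_point v' w' \<in> S"
      by (intro subsetD[OF S]) (simp add: s)
    then show "(1 - t) *\<^sub>R p + t *\<^sub>R tri_point (real j + 1/3) (real k + 1/3) \<in> S"
      by (simp add: p_eq v'_def w'_def)
  qed
  show "upward_triangle s i j k \<subseteq> closure S" if "int (i + j + k) = s"
  proof (rule subset_closure_if_open_segments)
    have s: "real_of_int s = real i + real j + real k" using that by linarith
    fix p and t :: real assume p: "p \<in> upward_triangle s i j k" and t: "0 < t" "t \<le> 1"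
    define v w where "v = coord_v p" and "w = coord_w p"
    have p_eq: "p = tri_point v w" by (simp add: v_def w_def)
    have nn: "0 \<le> v + w - real j - real k - 1" "0 \<le> real j + 1 - v" "0 \<le> real k + 1 - w"
      using p s by (auto simp: p_eq upward_triangle_def)
    define v' w' where "v' = (1 - t) * v + t * (real j + 2/3)" and "w' = (1 - t) * w + t * (real k + 2/3)"
    have "0 < v' + w' - real j - real k - 1" "0 < real j + 1 - v'" "0 < real k + 1 - w'"
      using mix[OF nn(1), of "1/3" t] mix[OF nn(2), of "1/3" t] mix[OF nn(3), of "1/3" t] t
      by (simp_all add: v'_def w'_def algebra_simps)
    then have "tri_point v' w' \<in> S"
      by (intro subsetD[OF S]) (simp add: s)
    then show "(1 - t) *\<^sub>R p + t *\<^sub>R tri_point (real j + 2/3) (real k + 2/3) \<in> S"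
      by (simp add: p_eq v'_def w'_def)
  qed
qed

text \<open>One inclusion holds triangle by triangle, by passing to open triangles and taking closures; for the
  other, the region is closed, so the closure in \<open>punctured\<close> adds nothing to the points covered by
  \<open>lattice_cell_cover\<close>.\<close>

lemma interlaced_basis_region_eq:
  fixes I :: "'k::comm_ring_1 poly3 set" and a b c \<alpha> \<beta> \<gamma> :: nat
  assumes I: "I = ideal_generated {varX ^ a, varY ^ b, varZ ^ c, varX ^ \<alpha> * varY ^ \<beta> * varZ ^ \<gamma>}"
    and lt: "\<alpha> < a" "\<beta> < b" "\<gamma> < c" and le: "int (\<alpha> + \<beta> + \<gamma>) \<le> s + 2"
  shows "interlaced_basis_region I s = punctured
           (tri_set s (\<lambda>u v w. 0 \<le> u \<and> u \<le> a \<and> 0 \<le> v \<and> v \<le> b \<and> 0 \<le> w \<and> w \<le> c))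
           (tri_set s (\<lambda>u v w. \<alpha> \<le> u \<and> \<beta> \<le> v \<and> \<gamma> \<le> w))"
    (is "?R = punctured ?H ?T")
proof
  have notin: "mono3 i j k \<notin> I \<longleftrightarrow> i < a \<and> j < b \<and> k < c \<and> (i < \<alpha> \<or> j < \<beta> \<or> k < \<gamma>)" for i j k
    unfolding I mono3_in_ideal_iff by auto
  have interior: "tri_set s (\<lambda>u v w. real i < u \<and> u < real i + 1 \<and> real j < v \<and> v < real j + 1
      \<and> real k < w \<and> w < real k + 1)
      \<subseteq> ?H - ?T" if "mono3 i j k \<notin> I" for i j k :: nat
  proof -
    have "real i + 1 \<le> a" "real j + 1 \<le> b" "real k + 1 \<le> c"
      "real i + 1 \<le> \<alpha> \<or> real j + 1 \<le> \<beta> \<or> real k + 1 \<le> \<gamma>"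
      using that unfolding notin by linarith+
    then show ?thesis by (auto simp: tri_set_eq_Collect)
  qed
  show "?R \<subseteq> punctured ?H ?T"
    unfolding interlaced_basis_region_def punctured_def
    using unit_triangles_subset_closure[OF interior] by blast
  have "?H - ?T \<subseteq> ?R"
  proof
    fix z assume z: "z \<in> ?H - ?T"
    define v w u where "v = coord_v z" and "w = coord_w z" and "u = real_of_int s + 2 - v - w"
    have z_eq: "z = tri_point v w" by (simp add: v_def w_def)
    have sum: "u + v + w = real_of_int (s + 2)" by (simp add: u_def)
    have uvw: "0 \<le> u" "u \<le> a" "0 \<le> v" "v \<le> b" "0 \<le> w" "w \<le> c" "u < \<alpha> \<or> v < \<beta> \<or> w < \<gamma>"
      using z by (auto simp: z_eq u_def)
    have pos: "0 < a" "0 < b" "0 < c" using lt by auto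
    have in_down: "z \<in> ?R" if "mono3 i j k \<notin> I" "int (i + j + k) = s + 1" "i \<le> u" "j \<le> v" "k \<le> w"
      for i j k :: nat
    proof -
      have "z \<in> downward_triangle s i j k" using that by (simp add: z_eq downward_triangle_def u_def)
      then show ?thesis unfolding interlaced_basis_region_def using that by blast
    qed
    have in_up: "z \<in> ?R" if "mono3 i j k \<notin> I" "int (i + j + k) = s"
        "u \<le> real i + 1" "v \<le> real j + 1" "w \<le> real k + 1"
      for i j k :: nat
    proof -
      have "z \<in> upward_triangle s i j k" using that by (simp add: z_eq upward_triangle_def u_def)
      then show ?thesis unfolding interlaced_basis_region_def using that by blast
    qed
    \<comment> \<open>the three cases differ by a rotation of the coordinates\<close>
    from uvw(7) consider "u < \<alpha>" | "v < \<beta>" | "w < \<gamma>" by blast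
    then show "z \<in> ?R"
    proof cases
      case 1
      have T: "u + v + w = real_of_int (s + 2)" "int \<alpha> \<le> s + 2" using sum le by auto
      from T(1) uvw(1,3-6) 1 T(2) pos(2,3) show ?thesis
      proof (cases rule: lattice_cell_cover)
        case (down i j k)
        then show ?thesis using lt by (intro in_down[of i j k]) (simp_all add: notin)
      next
        case (up i j k)
        then show ?thesis using lt by (intro in_up[of i j k]) (simp_all add: notin)
      qed
    next
      case 2
      have T: "v + w + u = real_of_int (s + 2)" "int \<beta> \<le> s + 2" using sum le by auto
      from T(1) uvw(3,5,6,1,2) 2 T(2) pos(3,1) show ?thesis
      proof (cases rule: lattice_cell_cover)
        case (down i j k)
        then show ?thesis using lt by (intro in_down[of k i j]) (simp_all add: notin)
      next
        case (up i j k)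
        then show ?thesis using lt by (intro in_up[of k i j]) (simp_all add: notin)
      qed
    next
      case 3
      have T: "w + u + v = real_of_int (s + 2)" "int \<gamma> \<le> s + 2" using sum le by auto
      from T(1) uvw(5,1-4) 3 T(2) pos(1,2) show ?thesis
      proof (cases rule: lattice_cell_cover)
        case (down i j k)
        then show ?thesis using lt by (intro in_down[of j k i]) (simp_all add: notin)
      next
        case (up i j k)
        then show ?thesis using lt by (intro in_up[of j k i]) (simp_all add: notin)
      qed
    qed
  qed
  then show "punctured ?H ?T \<subseteq> ?R"
    unfolding punctured_def by (rule closure_minimal) (rule closed_interlaced_basis_region)
qed

theorem theorem4p1:
  fixes I :: "'k::field poly3 set"
    and a b c \<alpha> \<beta> \<gamma> :: nat
    and s A B C M :: int
  assumes "infinite (UNIV :: 'k set)"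
    and "I = ideal_generated {varX ^ a, varY ^ b, varZ ^ c, varX ^ \<alpha> * varY ^ \<beta> * varZ ^ \<gamma>}"
    and "\<alpha> < a" and "\<beta> < b" and "\<gamma> < c"
    and "\<not> (\<alpha> = 0 \<and> \<beta> = 0)" and "\<not> (\<alpha> = 0 \<and> \<gamma> = 0)" and "\<not> (\<beta> = 0 \<and> \<gamma> = 0)"
    and "(a + b + c + \<alpha> + \<beta> + \<gamma>) mod 3 = 0"
    and "s = int (a + b + c + \<alpha> + \<beta> + \<gamma>) div 3 - 2"
    and "A = s + 2 - int a" and "B = s + 2 - int b" and "C = s + 2 - int c"
    and "M = s + 2 - int (\<alpha> + \<beta> + \<gamma>)"
    and "0 \<le> M"
    and "0 \<le> A" and "A \<le> int (\<beta> + \<gamma>)"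
    and "0 \<le> B" and "B \<le> int (\<alpha> + \<gamma>)"
    and "0 \<le> C" and "C \<le> int (\<alpha> + \<beta>)"
  shows "\<exists>P Qu Qv Qw.
      clockwise_hexagon (map real_of_int [A, B + M, C, A + M, B, C + M]) P \<and>
      side_line P 0 = tri_set s (\<lambda>u v w. u = real a) \<and>
      side_line P 1 = tri_set s (\<lambda>u v w. v = 0) \<and>
      side_line P 2 = tri_set s (\<lambda>u v w. w = real c) \<and>
      side_line P 3 = tri_set s (\<lambda>u v w. u = 0) \<and>
      side_line P 4 = tri_set s (\<lambda>u v w. v = real b) \<and>
      side_line P 5 = tri_set s (\<lambda>u v w. w = 0) \<and>
      equilateral_triangle (real_of_int M) Qu Qv Qw \<and>
      convex hull {Qu, Qv, Qw} \<subseteq> hex_region P \<and>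
      interlaced_basis_region I s = punctured (hex_region P) (convex hull {Qu, Qv, Qw}) \<and>
      parallel_at_distance Qv Qw P 3 (real \<alpha>) \<and>
      parallel_at_distance Qw Qu P 1 (real \<beta>) \<and>
      parallel_at_distance Qu Qv P 5 (real \<gamma>)"
proof -
  note I = assms(2) and lt = assms(3-5)
  define T where "T = real_of_int s + 2"
  have "3 dvd a + b + c + \<alpha> + \<beta> + \<gamma>"
    using assms(9) by (simp only: dvd_eq_mod_eq_0)
  then obtain n where "a + b + c + \<alpha> + \<beta> + \<gamma> = 3 * n" by (rule dvdE)
  then have "3 * (s + 2) = int (a + b + c + \<alpha> + \<beta> + \<gamma>)" by (simp only: assms(10)) simp
  then have sum: "A + B + C + M = s + 2" using assms(11-14) by (simp add: algebra_simps)
  have ABCM: "real_of_int A = T - a" "real_of_int B = T - b" "real_of_int C = T - c"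
      "real_of_int M = T - \<alpha> - \<beta> - \<gamma>"
    using assms(11-14) by (simp_all add: T_def)
  have sumR: "real_of_int A + B + C + M = T"
    using arg_cong[OF sum, of real_of_int] by (simp add: T_def)
  have nonneg: "0 \<le> real_of_int A" "0 \<le> real_of_int B" "0 \<le> real_of_int C" "0 \<le> real_of_int M"
    using assms(15,16,18,20) by simp_all
  have bounds: "real_of_int A \<le> \<beta> + \<gamma>" "real_of_int B \<le> \<alpha> + \<gamma>" "real_of_int C \<le> \<alpha> + \<beta>"
    using assms(17,19,21) by linarith+
  define vs where "vs = [tri_point A 0, tri_point 0 A, tri_point 0 c,
      tri_point C c, tri_point b B, tri_point b 0]"
  define P where "P i = vs ! i" for i
  define Qu Qv Qw where "Qu = tri_point \<beta> \<gamma>" and "Qv = tri_point (real \<beta> + M) \<gamma>"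
    and "Qw = tri_point \<beta> (real \<gamma> + M)"
  have P: "P 0 = tri_point A 0" "P 1 = tri_point 0 A" "P 2 = tri_point 0 c"
      "P 3 = tri_point C c" "P 4 = tri_point b B" "P 5 = tri_point b 0"
    by (simp_all add: P_def vs_def)
  have hexagon: "clockwise_hexagon (map real_of_int [A, B + M, C, A + M, B, C + M]) P"
  proof -
    have "clockwise_hexagon [real_of_int A, real_of_int B + real_of_int M, real_of_int C,
        real_of_int A + real_of_int M, real_of_int B, real_of_int C + real_of_int M] P"
      by (rule clockwise_hexagonI; (unfold P hex_dir_eq_tri_point tri_point_linear tri_point_inject)?)
         (use nonneg sumR ABCM in auto)
    then show ?thesis by simp
  qed

  have H: "hex_region P = tri_set s (\<lambda>u v w. 0 \<le> u \<and> u \<le> a \<and> 0 \<le> v \<and> v \<le> b \<and> 0 \<le> w \<and> w \<le> c)"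
    unfolding hex_region_def lessThan_6
    using convex_hull_hexagon[OF T_def, of a b c] nonneg sumR ABCM
    by (simp only: image_insert image_empty P)
  have Q: "convex hull {Qu, Qv, Qw} = tri_set s (\<lambda>u v w. \<alpha> \<le> u \<and> \<beta> \<le> v \<and> \<gamma> \<le> w)"
    unfolding Qu_def Qv_def Qw_def using nonneg ABCM by (intro convex_hull_triangle) (auto simp: T_def)

  have "convex hull {Qu, Qv, Qw} \<subseteq> hex_region P"
    unfolding H Q using bounds ABCM by (auto simp: tri_set_eq_Collect T_def)
  moreover have "interlaced_basis_region I s = punctured (hex_region P) (convex hull {Qu, Qv, Qw})"
    unfolding H Q using assms(14,15) by (intro interlaced_basis_region_eq[OF I lt]) simp
  moreover have "equilateral_triangle (real_of_int M) Qu Qv Qw"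
    unfolding equilateral_triangle_def Qu_def Qv_def Qw_def dist_norm
    using nonneg by (simp add: norm_tri_point)
  moreover have
    "side_line P 0 = tri_set s (\<lambda>u v w. u = real a)" "side_line P 3 = tri_set s (\<lambda>u v w. u = 0)"
    unfolding side_line_def P hex_dir_eq_tri_point
    using ABCM line_through_u[of "- 1" A 0 s a] line_through_u[of 1 C c s 0] by (simp_all add: T_def)
  moreover have
    "side_line P 1 = tri_set s (\<lambda>u v w. v = 0)" "side_line P 4 = tri_set s (\<lambda>u v w. v = real b)"
    unfolding side_line_def P hex_dir_eq_tri_point by (simp_all add: line_through_v)
  moreover have
    "side_line P 2 = tri_set s (\<lambda>u v w. w = real c)" "side_line P 5 = tri_set s (\<lambda>u v w. w = 0)"
    unfolding side_line_def P hex_dir_eq_tri_point by (simp_all add: line_through_w)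
  \<comment> \<open>\<open>Qu\<close>, \<open>Qv\<close>, \<open>Qw\<close> run anticlockwise and the sides clockwise, whence the factor \<open>- M\<close>\<close>
  moreover have "parallel_at_distance Qv Qw P 3 (real \<alpha>)"
    unfolding Qv_def Qw_def
    by (rule parallel_at_distance_tri_point[where P = P, OF P(4) hex_dir_eq_tri_point(4), where r = "- M"])
      (use ABCM in \<open>auto simp: norm_tri_point\<close>)
  moreover have "parallel_at_distance Qw Qu P 1 (real \<beta>)"
    unfolding Qw_def Qu_def
    by (rule parallel_at_distance_tri_point[where P = P, OF P(2) hex_dir_eq_tri_point(2), where r = "- M"])
      (auto simp: norm_tri_point)
  moreover have "parallel_at_distance Qu Qv P 5 (real \<gamma>)"
    unfolding Qu_def Qv_def
    by (rule parallel_at_distance_tri_point[where P = P, OF P(6) hex_dir_eq_tri_point(6), where r = "- M"])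
      (auto simp: norm_tri_point)
  ultimately show ?thesis using hexagon
    by (intro exI[of _ P] exI[of _ Qu] exI[of _ Qv] exI[of _ Qw] conjI)
qed

end
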